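(* Let $q=2^m$ with $m$ a positive integer, let $f\in\mathbb{F}_q[x]$ be an o-polynomial, let $v\in\mathbb{F}_q\setminus\{f(x)+x : x\in\mathbb{F}_q\}$, and write $\mathbb{F}_q=\{\alpha_1,\ldots,\alpha_{q-1},\alpha_q\}$ with $\alpha_q=0$. Let $\mathcal{C}_v$ be the $[q+5,3,q+2]$ NMDS code over $\mathbb{F}_q$ with generator matrix $$G_v=\begin{pmatrix} f(\alpha_1) & f(\alpha_2) & \cdots & f(\alpha_{q-1}) & f(\alpha_q) & 1 & 0 & 1 & 0 & v\\ \alpha_1 & \alpha_2 & \cdots & \alpha_{q-1} & \alpha_q & 0 & 1 & 1 & v & 0\\ 1 & 1 & \cdots & 1 & 1 & 0 & 0 & 0 & 1 & 1\end{pmatrix}.$$ Then $\mathcal{C}_v$ (with locality $r=2$) and its dual code $\mathcal{C}_v^{\perp}$ (with locality $r=q+1$) are both $d$-optimal and $k$-optimal LRC codes.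
   Context: An $[n,k,d]$ linear code over $\mathbb{F}_q$ is a $k$-dimensional subspace $\mathcal{C}$ of $\mathbb{F}_q^n$ with minimum nonzero Hamming weight $d$. Its dual $\mathcal{C}^\perp$ is taken with respect to the Euclidean inner product. The Singleton defect of an $[n,k,d]$ code is $s(\mathcal{C})=n-k+1-d$; $\mathcal{C}$ is near maximum distance separable (NMDS) if $s(\mathcal{C})=s(\mathcal{C}^\perp)=1$. For $q$ a power of $2$, an o-polynomial (oval polynomial) over $\mathbb{F}_q$ is a permutation polynomial $f\in\mathbb{F}_q[x]$ of $\mathbb{F}_q$ such that (1) $\deg f<q$, $f(0)=0$, $f(1)=1$; and (2) for each $a\in\mathbb{F}_q$, $g_a(x):=(f(x+a)+f(a))x^{q-2}$ is also a permutation polynomial of $\mathbb{F}_q$. A code $\mathcal{C}$ of length $n$ has locality $r$ if for every $i\in[n]=\{1,\ldots,n\}$ there exist a subset $R_i\subseteq[n]\setminus\{i\}$ with $\#R_i\le r$ and a function $\phi_i$ such that $c_i=\phi_i(\{c_j : j\in R_i\})$ for every codeword $(c_1,\ldots,c_n)\in\mathcal{C}$. An $(n,k,r)$-LRC code (locally recoverable code) over $\mathbb{F}_q$ is a code of length $n$, cardinality $q^k$ and locality $r$. An $(n,k,r)$-LRC code with minimum distance $d$ is $d$-optimal if $d=n-k-\lceil k/r\rceil+2$. It is $k$-optimal if $$k=\min_{t\in\mathbb{Z}^{+}}\left[tr+k_{\mathrm{opt}}^{(q)}(n-t(r+1),d)\right],$$ where $\mathbb{Z}^+$ is the set of positive integers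 and $k_{\mathrm{opt}}^{(q)}(n',d)$ is the largest possible dimension ($\log_q$ of the cardinality) of a code of length $n'$ over an alphabet of size $q$ with minimum distance at least $d$ (a one-word code being allowed, of dimension $0$), with the convention $k_{\mathrm{opt}}^{(q)}(n',d)=0$ for $n'\le 0$. *)

theory Defs
  imports
    "HOL-Computational_Algebra.Polynomial"
    "HOL-Library.FuncSet"
    "HOL-Library.Cardinality"
    "Jordan_Normal_Form.VS_Connect"
    Complex_Main
begin

section \<open>O-polynomials\<close>

definition permutation_poly :: "'a::field poly \<Rightarrow> bool" where
  "permutation_poly p \<longleftrightarrow> bij (poly p)"

text \<open>The second argument of \<open>pcompose\<close> is the polynomial \<open>x + a\<close>. For \<open>q = 2\<close> the factor
  \<open>x ^ (q - 2)\<close> is the constant polynomial \<open>1\<close>.\<close>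

definition o_poly_quotient :: "'a::{field,finite} poly \<Rightarrow> 'a \<Rightarrow> 'a poly" where
  "o_poly_quotient f a = (pcompose f [:a, 1:] + [:poly f a:]) * monom 1 (CARD('a) - 2)"

definition o_polynomial :: "'a::{field,finite} poly \<Rightarrow> bool" where
  "o_polynomial f \<longleftrightarrow>
     permutation_poly f \<and>
     degree f < CARD('a) \<and> poly f 0 = 0 \<and> poly f 1 = 1 \<and>
     (\<forall>a. permutation_poly (o_poly_quotient f a))"


section \<open>Codes\<close>

text \<open>A code of length \<open>n\<close> over \<open>A\<close> is a set of vectors of dimension \<open>n\<close> with entries in \<open>A\<close>;
  coordinates are numbered \<open>0, \<dots>, n - 1\<close>.\<close>

definition code_over :: "'a set \<Rightarrow> nat \<Rightarrow> 'a vec set \<Rightarrow> bool" where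
  "code_over A n C \<longleftrightarrow> C \<noteq> {} \<and> C \<subseteq> carrier_vec n \<and> (\<forall>c\<in>C. \<forall>i<n. c $ i \<in> A)"

definition hamming_dist :: "'a vec \<Rightarrow> 'a vec \<Rightarrow> nat" where
  "hamming_dist u w = card {i. i < dim_vec u \<and> u $ i \<noteq> w $ i}"

definition hamming_weight :: "'a::zero vec \<Rightarrow> nat" where
  "hamming_weight u = card {i. i < dim_vec u \<and> u $ i \<noteq> 0}"

text \<open>\<open>min_dist\<close> is meaningful for codes with at least two words and \<open>min_weight\<close> for codes with
  a nonzero word; otherwise \<open>Min\<close> is applied to the empty set.\<close>

definition min_dist :: "'a vec set \<Rightarrow> nat" where
  "min_dist C = Min {hamming_dist u w | u w. u \<in> C \<and> w \<in> C \<and> u \<noteq> w}"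

definition min_weight :: "nat \<Rightarrow> 'a::zero vec set \<Rightarrow> nat" where
  "min_weight n C = Min {hamming_weight c | c. c \<in> C \<and> c \<noteq> 0\<^sub>v n}"

definition linear_code :: "nat \<Rightarrow> 'a::field vec set \<Rightarrow> bool" where
  "linear_code n C \<longleftrightarrow> subspace class_ring C (module_vec TYPE('a) n)"

definition code_dim :: "nat \<Rightarrow> 'a::field vec set \<Rightarrow> nat" where
  "code_dim n C = vectorspace.dim class_ring (module_vec TYPE('a) n\<lparr>carrier := C\<rparr>)"

text \<open>The existence of a nonzero word makes \<open>min_weight\<close> a genuine minimum.\<close>

definition linear_code_params :: "nat \<Rightarrow> nat \<Rightarrow> nat \<Rightarrow> 'a::field vec set \<Rightarrow> bool" where
  "linear_code_params n k d C \<longleftrightarrow>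
     linear_code n C \<and> code_dim n C = k \<and> (\<exists>c\<in>C. c \<noteq> 0\<^sub>v n) \<and> min_weight n C = d"

definition dual_code :: "nat \<Rightarrow> 'a::field vec set \<Rightarrow> 'a vec set" where
  "dual_code n C = vec_module.orthogonal_complement n C"

definition singleton_defect :: "nat \<Rightarrow> 'a::field vec set \<Rightarrow> int" where
  "singleton_defect n C = int n - int (code_dim n C) + 1 - int (min_weight n C)"

definition NMDS :: "nat \<Rightarrow> 'a::field vec set \<Rightarrow> bool" where
  "NMDS n C \<longleftrightarrow>
     linear_code n C \<and> singleton_defect n C = 1 \<and> singleton_defect n (dual_code n C) = 1"


section \<open>Locally recoverable codes\<close>

text \<open>The recovery function \<open>\<phi>\<close> sees only the coordinates in \<open>R\<close>, because its argument is the
  restriction of the codeword to \<open>R\<close>.\<close>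

definition has_locality :: "nat \<Rightarrow> nat \<Rightarrow> 'a vec set \<Rightarrow> bool" where
  "has_locality n r C \<longleftrightarrow>
     (\<forall>i<n. \<exists>R \<phi>. R \<subseteq> {..<n} - {i} \<and> card R \<le> r \<and>
        (\<forall>c\<in>C. c $ i = \<phi> (restrict (\<lambda>j. c $ j) R)))"

definition LRC :: "nat \<Rightarrow> nat \<Rightarrow> nat \<Rightarrow> 'a::finite vec set \<Rightarrow> bool" where
  "LRC n k r C \<longleftrightarrow> code_over UNIV n C \<and> card C = CARD('a) ^ k \<and> has_locality n r C"

definition d_optimal_LRC :: "nat \<Rightarrow> nat \<Rightarrow> nat \<Rightarrow> 'a::finite vec set \<Rightarrow> bool" where
  "d_optimal_LRC n k r C \<longleftrightarrow>
     LRC n k r C \<and> int (min_dist C) = int n - int k - \<lceil>real k / real r\<rceil> + 2"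

text \<open>Arbitrary, not necessarily linear, codes are considered, and the alphabet \<open>{..<q}\<close> stands
  for any alphabet of size \<open>q\<close>. The length is an integer because \<open>n - t * (r + 1)\<close> may be negative.\<close>

definition k_opt :: "nat \<Rightarrow> int \<Rightarrow> nat \<Rightarrow> real" where
  "k_opt q n d =
     (if n \<le> 0 then 0
      else Max {log (real q) (real (card C)) | C.
                  code_over {..<q} (nat n) C \<and>
                  (\<forall>u\<in>C. \<forall>w\<in>C. u \<noteq> w \<longrightarrow> d \<le> hamming_dist u w)})"

definition is_minimum :: "real set \<Rightarrow> real \<Rightarrow> bool" where
  "is_minimum S x \<longleftrightarrow> x \<in> S \<and> (\<forall>y\<in>S. x \<le> y)"

definition k_optimal_LRC :: "nat \<Rightarrow> nat \<Rightarrow> nat \<Rightarrow> 'a::finite vec set \<Rightarrow> bool" where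
  "k_optimal_LRC n k r C \<longleftrightarrow>
     LRC n k r C \<and>
     is_minimum
       {real (t * r) + k_opt CARD('a) (int n - int t * (int r + 1)) (min_dist C) | t :: nat. t \<ge> 1}
       (real k)"


section \<open>The code \<open>C\<^sub>v\<close>\<close>

definition gen_matrix :: "'a::{field,finite} poly \<Rightarrow> (nat \<Rightarrow> 'a) \<Rightarrow> 'a \<Rightarrow> 'a mat" where
  "gen_matrix f \<alpha> v =
     mat_of_rows_list (CARD('a) + 5)
       [map (\<lambda>i. poly f (\<alpha> i)) [1..<CARD('a) + 1] @ [1, 0, 1, 0, v],
        map (\<lambda>i. \<alpha> i)          [1..<CARD('a) + 1] @ [0, 1, 1, v, 0],
        map (\<lambda>i. 1)             [1..<CARD('a) + 1] @ [0, 0, 0, 1, 1]]"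

definition code_v :: "'a::{field,finite} poly \<Rightarrow> (nat \<Rightarrow> 'a) \<Rightarrow> 'a \<Rightarrow> 'a vec set" where
  "code_v f \<alpha> v = vec_space.row_space (CARD('a) + 5) (gen_matrix f \<alpha> v)"

end

theory Submission
  imports Defs "HOL-Number_Theory.Residues"
begin

text \<open>The columns of \<open>G\<^sub>v\<close> are points of the projective plane. The points \<open>(f(x), x, 1)\<close>, \<open>(1, 0, 0)\<close>
  and \<open>(0, 1, 0)\<close> form a hyperoval, which every line meets in at most two points. The remaining points
  \<open>(1, 1, 0)\<close>, \<open>(0, v, 1)\<close> and \<open>(v, 0, 1)\<close> lie on the line \<open>X + Y = v Z\<close>, which misses the hyperoval by
  the choice of \<open>v\<close>; any other line contains at most one of them. So no line contains more than three
  columns, and nonzero codewords have weight at least \<open>q + 2\<close>. Every column lies on a line with exactly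
  three columns, and off another such line, so every coordinate is in the support of a minimum weight word of
  the dual and of the code. Both codes then have \<open>k = r + 1\<close> and \<open>d = n - k\<close>, which gives both optimality
  properties at once.\<close>

section \<open>Linear codes and locality\<close>

text \<open>Trades the record-based notion of subspace for closure conditions on a set of vectors,
  the form in which linearity is checked and used below.\<close>

lemma linear_code_iff:
  "linear_code n C \<longleftrightarrow> C \<subseteq> carrier_vec n \<and> 0\<^sub>v n \<in> C \<and>
     (\<forall>u\<in>C. \<forall>w\<in>C. u + w \<in> C) \<and> (\<forall>a. \<forall>u\<in>C. a \<cdot>\<^sub>v u \<in> C)"
proof -
  interpret vec_space "TYPE('a)" n .
  show ?thesis
    unfolding linear_code_def VectorSpace.subspace_def submodule_def
    by (auto simp: vec_vs module_vec_simps class_ring_simps vec_module)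
qed

lemma linear_code_minus:
  assumes "linear_code n C" "u \<in> C" "w \<in> C"
  shows "u - w \<in> C"
proof -
  have "u \<in> carrier_vec n" "w \<in> carrier_vec n" "u + (-1) \<cdot>\<^sub>v w \<in> C"
    using assms by (auto simp: linear_code_iff)
  moreover from this have "u - w = u + (-1) \<cdot>\<^sub>v w"
    by (intro eq_vecI) auto
  ultimately show ?thesis by simp
qed

section \<open>Cardinality and dimension\<close>

lemma (in vectorspace) card_carrier_eq_power_dim:
  assumes "fin_dim"
  shows "card (carrier V) = card (carrier K) ^ dim"
proof -
  obtain B where B: "finite B" "basis B"
    using finite_basis_exists[OF assms] by blast
  have BV: "B \<subseteq> carrier V" using B(2) by (simp add: basis_def)
  have uniq: "\<forall>v. v \<in> carrier V \<longrightarrow> (\<exists>!a. a \<in> B \<rightarrow>\<^sub>E carrier K \<and> lincomb a B = v)"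
    using basis_criterion[OF B(1) BV] B(2) by blast
  have closed: "lincomb a B \<in> carrier V" if "a \<in> B \<rightarrow>\<^sub>E carrier K" for a
    using that BV by (intro lincomb_closed) auto
  \<comment> \<open>Coordinates with respect to \<open>B\<close>. Taking the coefficient functions
    extensional makes them literally unique, so they can be counted.\<close>
  have "bij_betw (\<lambda>a. lincomb a B) (B \<rightarrow>\<^sub>E carrier K) (carrier V)"
    unfolding bij_betw_def
  proof
    show "inj_on (\<lambda>a. lincomb a B) (B \<rightarrow>\<^sub>E carrier K)"
      using uniq closed by (intro inj_onI) metis
    show "(\<lambda>a. lincomb a B) ` (B \<rightarrow>\<^sub>E carrier K) = carrier V"
      using uniq closed by blast
  qed
  then have "card (carrier V) = card (B \<rightarrow>\<^sub>E carrier K)"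
    by (simp add: bij_betw_same_card)
  then show ?thesis
    using B by (simp add: card_PiE dim_basis)
qed

text \<open>The whole carrier serves as a finite generating set.\<close>

lemma (in vectorspace) fin_dim_if_finite:
  assumes "finite (carrier V)"
  shows "fin_dim"
  unfolding fin_dim_def
  using assms in_own_span[of "carrier V"] span_is_subset2[of "carrier V"] by blast

lemma finite_vecs:
  assumes "finite A"
  shows "finite {w \<in> carrier_vec n. \<forall>i<n. w $ i \<in> A}" (is "finite ?W")
proof (rule finite_subset)
  show "?W \<subseteq> vec n ` ({..<n} \<rightarrow>\<^sub>E A)"
  proof
    fix w assume w: "w \<in> ?W"
    then have "w = vec n (restrict (\<lambda>i. w $ i) {..<n})"
      by (intro eq_vecI) auto
    moreover have "restrict (\<lambda>i. w $ i) {..<n} \<in> {..<n} \<rightarrow>\<^sub>E A"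
      using w by auto
    ultimately show "w \<in> vec n ` ({..<n} \<rightarrow>\<^sub>E A)" by blast
  qed
qed (intro finite_imageI finite_PiE finite_lessThan assms)

text \<open>Converts the dimension into the cardinality clause of \<open>LRC\<close>.\<close>

lemma card_linear_code:
  fixes C :: "'a::{field,finite} vec set"
  assumes "linear_code n C"
  shows "card C = CARD('a) ^ code_dim n C"
proof -
  interpret V: vec_space "TYPE('a)" n .
  have sub: "VectorSpace.subspace class_ring C V.V" using assms by (simp add: linear_code_def)
  interpret W: vectorspace class_ring "V.vs C"
    by (rule V.subspace_is_vs[OF sub])
  have "finite C"
  proof (rule finite_subset)
    show "C \<subseteq> {w \<in> carrier_vec n. \<forall>i<n. w $ i \<in> UNIV}"
      using assms by (auto simp: linear_code_iff)
  qed (rule finite_vecs, rule finite_class.finite_UNIV)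
  then have "W.fin_dim"
    by (intro W.fin_dim_if_finite) simp
  from W.card_carrier_eq_power_dim[OF this] show ?thesis
    by (simp add: code_dim_def class_ring_simps)
qed

section \<open>Minimum distance and minimum weight\<close>

lemma hamming_dist_eq_weight:
  assumes "u \<in> carrier_vec n" "w \<in> carrier_vec n"
  shows "hamming_dist u w = hamming_weight (u - w :: 'a::field vec)"
  using assms unfolding hamming_dist_def hamming_weight_def
  by (intro arg_cong[where f = card]) auto

text \<open>Differences of distinct words are nonzero words, and a weight is the distance to the
  zero word, so the two sets under \<open>Min\<close> agree.\<close>

lemma min_dist_linear_code:
  assumes "linear_code n C"
  shows "min_dist C = min_weight n C"
proof -
  have "{hamming_dist u w | u w. u \<in> C \<and> w \<in> C \<and> u \<noteq> w}
      = {hamming_weight c | c. c \<in> C \<and> c \<noteq> 0\<^sub>v n}" (is "?L = ?R")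
  proof
    show "?L \<subseteq> ?R"
    proof
      fix d assume "d \<in> ?L"
      then obtain u w where uw: "d = hamming_dist u w" "u \<in> C" "w \<in> C" "u \<noteq> w" by blast
      have carr: "u \<in> carrier_vec n" "w \<in> carrier_vec n"
        using uw assms by (auto simp: linear_code_iff)
      have "u - w \<noteq> 0\<^sub>v n"
      proof
        assume *: "u - w = 0\<^sub>v n"
        have "u $ i = w $ i" if "i < n" for i
          using arg_cong[OF *, of "\<lambda>x. x $ i"] carr that by simp
        then show False using uw(4) carr by (auto intro: eq_vecI)
      qed
      then show "d \<in> ?R"
        using uw linear_code_minus[OF assms uw(2,3)] hamming_dist_eq_weight[OF carr] by auto
    qed
    show "?R \<subseteq> ?L"
    proof
      fix d assume "d \<in> ?R"
      then obtain c where c: "d = hamming_weight c" "c \<in> C" "c \<noteq> 0\<^sub>v n" by blast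
      moreover have "c \<in> carrier_vec n" "0\<^sub>v n \<in> C"
        using c assms by (auto simp: linear_code_iff)
      moreover from this have "hamming_dist c (0\<^sub>v n) = hamming_weight c"
        by (simp add: hamming_dist_eq_weight)
      ultimately show "d \<in> ?L" by (metis (mono_tags, lifting) mem_Collect_eq)
    qed
  qed
  then show ?thesis by (simp add: min_dist_def min_weight_def)
qed

text \<open>The upper bound on the witness and the lower bound on all nonzero words together make
  the witness attain d. The set under \<open>Min\<close> is finite because weights are at most
  n.\<close>

lemma min_weight_eqI:
  assumes "C \<subseteq> carrier_vec n" "c \<in> C" "c \<noteq> 0\<^sub>v n" "hamming_weight c \<le> d"
    and "\<And>u. u \<in> C \<Longrightarrow> u \<noteq> 0\<^sub>v n \<Longrightarrow> d \<le> hamming_weight u"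
  shows "min_weight n C = d"
  unfolding min_weight_def
proof (rule Min_eqI)
  have "hamming_weight u \<le> n" if "u \<in> C" for u
  proof -
    have "hamming_weight u \<le> card {..<dim_vec u}"
      unfolding hamming_weight_def by (intro card_mono) auto
    then show ?thesis using that assms(1) by auto
  qed
  then have "{hamming_weight c |c. c \<in> C \<and> c \<noteq> 0\<^sub>v n} \<subseteq> {..n}" by blast
  then show "finite {hamming_weight c |c. c \<in> C \<and> c \<noteq> 0\<^sub>v n}"
    using finite_atMost by (rule finite_subset)
  show "d \<le> y" if "y \<in> {hamming_weight c |c. c \<in> C \<and> c \<noteq> 0\<^sub>v n}" for y
    using that assms(5) by auto
  show "d \<in> {hamming_weight c |c. c \<in> C \<and> c \<noteq> 0\<^sub>v n}"
    using assms(2-5) by (metis (mono_tags, lifting) le_antisym mem_Collect_eq)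
qed

section \<open>Dual codes and recovery from parity checks\<close>

lemma dual_code_altdef:
  "dual_code n C = {h \<in> carrier_vec n. \<forall>c\<in>C. h \<bullet> c = 0}"
  unfolding dual_code_def vec_module.orthogonal_complement_def by simp

lemma linear_dual_code:
  assumes "C \<subseteq> carrier_vec n"
  shows "linear_code n (dual_code n C)"
proof -
  have "c \<in> carrier_vec n" if "c \<in> C" for c using assms that by blast
  then show ?thesis
    unfolding linear_code_iff dual_code_altdef by (auto simp: add_scalar_prod_distrib[where n = n])
qed

text \<open>Makes codewords into parity checks of the dual code, the source of its locality.\<close>

lemma subset_double_dual:
  assumes "C \<subseteq> carrier_vec n"
  shows "C \<subseteq> dual_code n (dual_code n (C :: 'a::field vec set))"
proof
  fix c assume "c \<in> C"
  moreover from this have "c \<in> carrier_vec n" using assms by blast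
  ultimately show "c \<in> dual_code n (dual_code n C)"
    unfolding dual_code_altdef using comm_scalar_prod[of _ n c] by fastforce
qed

text \<open>A dual word \<open>h\<close> with \<open>h\<^sub>i \<noteq> 0\<close> is a parity check that recovers the
  coordinate \<open>i\<close> from the rest of its support.\<close>

lemma has_localityI:
  fixes C :: "'a::field vec set"
  assumes C: "C \<subseteq> carrier_vec n"
    and cover: "\<And>i. i < n \<Longrightarrow> \<exists>h\<in>dual_code n C. h $ i \<noteq> 0 \<and> hamming_weight h \<le> r + 1"
  shows "has_locality n r C"
  unfolding has_locality_def
proof (intro allI impI)
  fix i assume i: "i < n"
  from cover[OF i] obtain h where h: "h \<in> dual_code n C" "h $ i \<noteq> 0" "hamming_weight h \<le> r + 1"
    by blast
  have hn: "h \<in> carrier_vec n" using h(1) by (simp add: dual_code_altdef)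
  define R where "R = {j. j < n \<and> h $ j \<noteq> 0} - {i}"
  define \<phi> where "\<phi> = (\<lambda>x. - (\<Sum>j\<in>R. h $ j * x j) / h $ i)"
  have "card R \<le> r"
    using h(2,3) hn i by (simp add: R_def hamming_weight_def)
  moreover have "c $ i = \<phi> (restrict (\<lambda>j. c $ j) R)" if c: "c \<in> C" for c
  proof -
    have "c \<in> carrier_vec n" using C c by blast
    then have "h \<bullet> c = (\<Sum>j<n. h $ j * c $ j)"
      by (simp add: scalar_prod_def atLeast0LessThan)
    moreover have "h \<bullet> c = 0" using h(1) c by (simp add: dual_code_altdef)
    ultimately have "0 = (\<Sum>j<n. h $ j * c $ j)" by simp
    also have "\<dots> = (\<Sum>j\<in>insert i R. h $ j * c $ j)"
      using i by (intro sum.mono_neutral_right) (auto simp: R_def)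
    also have "\<dots> = h $ i * c $ i + (\<Sum>j\<in>R. h $ j * c $ j)"
      by (subst sum.insert) (auto simp: R_def)
    finally have "h $ i * c $ i = - (\<Sum>j\<in>R. h $ j * c $ j)"
      by (simp add: eq_neg_iff_add_eq_0)
    then show ?thesis using h(2) by (simp add: \<phi>_def field_simps)
  qed
  ultimately show "\<exists>R \<phi>. R \<subseteq> {..<n} - {i} \<and> card R \<le> r \<and>
        (\<forall>c\<in>C. c $ i = \<phi> (restrict (\<lambda>j. c $ j) R))"
    by (intro exI[of _ R] exI[of _ \<phi>]) (auto simp: R_def)
qed

section \<open>The function \<open>k_opt\<close> and the optimality criterion\<close>

lemma finite_codes: "finite {C. code_over {..<q :: nat} n C}"
proof -
  have "{C. code_over {..<q} n C} \<subseteq> Pow {w \<in> carrier_vec n. \<forall>i<n. w $ i \<in> {..<q}}"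
    by (auto simp: code_over_def)
  then show ?thesis
    using finite_vecs[of "{..<q}" n] by (meson finite_Pow_iff finite_lessThan finite_subset)
qed

text \<open>A one-word code contributes \<open>log q 1 = 0\<close> to the maximum; q > 0 puts the
  zero word over the alphabet \<open>{..<q}\<close>.\<close>

lemma k_opt_nonneg:
  assumes "q > 0"
  shows "0 \<le> k_opt q n d"
proof (cases "n \<le> 0")
  case False
  let ?S = "{log (real q) (real (card C)) | C. code_over {..<q} (nat n) C \<and>
               (\<forall>u\<in>C. \<forall>w\<in>C. u \<noteq> w \<longrightarrow> d \<le> hamming_dist u w)}"
  have "?S \<subseteq> (\<lambda>C. log (real q) (real (card C))) ` {C. code_over {..<q} (nat n) C}" by auto
  then have "finite ?S" using finite_codes finite_surj by blast
  moreover have "log (real q) (real (card {0\<^sub>v (nat n)})) \<in> ?S"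
    using assms by (auto simp: code_over_def intro!: exI[of _ "{0\<^sub>v (nat n)}"])
  then have "0 \<in> ?S" by simp
  ultimately have "0 \<le> Max ?S" by (rule Max_ge)
  then show ?thesis using False by (simp add: k_opt_def)
qed (simp add: k_opt_def)

text \<open>Words at distance \<open>n\<close> differ in the first coordinate; the repetition code is extremal.\<close>

lemma k_opt_full_distance:
  assumes q: "q \<ge> 2" and n: "n \<ge> 1"
  shows "k_opt q (int n) n = 1"
proof -
  let ?good = "\<lambda>C. code_over {..<q} n C \<and> (\<forall>u\<in>C. \<forall>w\<in>C. u \<noteq> w \<longrightarrow> n \<le> hamming_dist u w)"
  have "Max {log (real q) (real (card C)) | C. ?good C} = 1"
  proof (rule Max_eqI)
    have "{log (real q) (real (card C)) | C. ?good C}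
        \<subseteq> (\<lambda>C. log (real q) (real (card C))) ` {C. code_over {..<q} n C}" by auto
    then show "finite {log (real q) (real (card C)) | C. ?good C}"
      using finite_codes finite_surj by blast
  next
    fix y assume "y \<in> {log (real q) (real (card C)) | C. ?good C}"
    then obtain C where y: "y = log (real q) (real (card C))" and C: "code_over {..<q} n C"
      and dist: "\<And>u w. u \<in> C \<Longrightarrow> w \<in> C \<Longrightarrow> u \<noteq> w \<Longrightarrow> n \<le> hamming_dist u w" by blast
    have "inj_on (\<lambda>u. u $ 0) C"
    proof (rule inj_onI, rule ccontr)
      fix u w assume uw: "u \<in> C" "w \<in> C" "u $ 0 = w $ 0" "u \<noteq> w"
      then have "hamming_dist u w \<le> card {1..<n}"
        using C unfolding hamming_dist_def code_over_def
        by (intro card_mono) (auto simp: subset_iff Suc_le_eq intro!: gr0I)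
      then show False using dist[OF uw(1,2,4)] n by simp
    qed
    moreover have "(\<lambda>u. u $ 0) ` C \<subseteq> {..<q}"
      using C n by (auto simp: code_over_def)
    ultimately have "card C \<le> q"
      using card_inj_on_le[of "\<lambda>u. u $ 0" C "{..<q}"] by simp
    \<comment> \<open>An infinite set would have \<open>card C = 0\<close>; finiteness makes the
      argument of the logarithm positive, so that monotonicity applies.\<close>
    moreover have "finite C"
    proof (rule inj_on_finite)
      show "inj_on (\<lambda>u. u $ 0) C" "(\<lambda>u. u $ 0) ` C \<subseteq> {..<q}" by fact+
    qed simp
    then have "card C > 0" using C by (auto simp: code_over_def card_gt_0_iff)
    ultimately show "y \<le> 1" using q by (simp add: y)
  next
    define C where "C = (\<lambda>a. vec n (\<lambda>_. a)) ` {..<q}"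
    have inj: "inj_on (\<lambda>a. vec n (\<lambda>_. a)) {..<q}"
    proof (rule inj_onI)
      fix a b :: nat assume "vec n (\<lambda>_. a) = vec n (\<lambda>_. b)"
      then have "vec n (\<lambda>_. a) $ 0 = vec n (\<lambda>_. b) $ 0" by simp
      then show "a = b" using n by simp
    qed
    have "hamming_dist (vec n (\<lambda>_. a)) (vec n (\<lambda>_. b)) = n" if "a \<noteq> b" for a b :: nat
      using that by (simp add: hamming_dist_def cong: conj_cong)
    moreover have "{..<q} \<noteq> {}" using q by (simp add: lessThan_empty_iff)
    ultimately have "?good C"
      by (auto simp: C_def code_over_def) (metis order_refl)
    moreover have "log (real q) (real (card C)) = 1"
      using q inj by (simp add: C_def card_image)
    ultimately show "1 \<in> {log (real q) (real (card C)) | C. ?good C}" by force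
  qed
  then show ?thesis using n by (simp add: k_opt_def)
qed

text \<open>With \<open>k = r + 1\<close> and \<open>d = n - k\<close>, the choice \<open>t = 1\<close> leaves a code of length \<open>n - (r + 1) = d\<close>,
  for which \<open>k_opt\<close> is \<open>1\<close>; for \<open>t \<ge> 2\<close> already \<open>t r \<ge> k\<close>.\<close>

lemma optimal_LRC_if_covered:
  fixes C :: "'a::{field,finite} vec set"
  assumes lin: "linear_code n C" and dim: "code_dim n C = r + 1" and r: "r \<ge> 2" and n: "n > r + 1"
    and d: "min_weight n C = n - (r + 1)"
    and cover: "\<And>i. i < n \<Longrightarrow> \<exists>h\<in>dual_code n C. h $ i \<noteq> 0 \<and> hamming_weight h \<le> r + 1"
  shows "d_optimal_LRC n (r + 1) r C" and "k_optimal_LRC n (r + 1) r C"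
proof -
  have C: "C \<subseteq> carrier_vec n" "C \<noteq> {}" using lin by (auto simp: linear_code_iff)
  have card2: "CARD('a) \<ge> 2"
  proof -
    have "card {0, 1 :: 'a} \<le> CARD('a)" by (intro card_mono) auto
    then show ?thesis by simp
  qed
  have LRC: "LRC n (r + 1) r C"
    using C has_localityI[OF C(1) cover] card_linear_code[OF lin]
    by (simp add: LRC_def code_over_def dim)
  have md: "min_dist C = n - (r + 1)" using min_dist_linear_code[OF lin] d by simp
  \<comment> \<open>As r \<ge> 2, the quotient 1 + 1/r lies strictly between 1 and 2; d-optimality
    then reads d = n - k.\<close>
  have "\<lceil>real (r + 1) / real r\<rceil> = 2"
    using r by (intro ceiling_unique) (auto simp: field_simps)
  then show "d_optimal_LRC n (r + 1) r C"
    using LRC md n by (simp add: d_optimal_LRC_def)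
  have "is_minimum {real (t * r) + k_opt CARD('a) (int n - int t * (int r + 1)) (n - (r + 1)) | t :: nat. t \<ge> 1}
       (real (r + 1))"
    unfolding is_minimum_def
  proof (intro conjI ballI)
    have len: "int n - int 1 * (int r + 1) = int (n - (r + 1))" using n by simp
    then have "real (r + 1) = real (1 * r) + k_opt CARD('a) (int n - int 1 * (int r + 1)) (n - (r + 1))"
      unfolding len using k_opt_full_distance[OF card2, of "n - (r + 1)"] n by linarith
    then show "real (r + 1) \<in> {real (t * r) + k_opt CARD('a) (int n - int t * (int r + 1)) (n - (r + 1)) | t :: nat. t \<ge> 1}"
      by blast
    fix y assume "y \<in> {real (t * r) + k_opt CARD('a) (int n - int t * (int r + 1)) (n - (r + 1)) | t :: nat. t \<ge> 1}"
    then obtain t :: nat where t: "t \<ge> 1"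
      and y: "y = real (t * r) + k_opt CARD('a) (int n - int t * (int r + 1)) (n - (r + 1))" by blast
    show "real (r + 1) \<le> y"
    proof (cases "t = 1")
      case True
      then show ?thesis using y \<open>real (r + 1) = _\<close> by simp
    next
      case False
      then have "2 * r \<le> t * r" using t by (intro mult_le_mono1) auto
      then have "r + 1 \<le> t * r" using r by linarith
      then have "real (r + 1) \<le> real (t * r)" by (rule of_nat_mono)
      moreover have "0 \<le> k_opt CARD('a) (int n - int t * (int r + 1)) (n - (r + 1))"
        using card2 by (intro k_opt_nonneg) simp
      ultimately show ?thesis using y by linarith
    qed
  qed
  then show "k_optimal_LRC n (r + 1) r C"
    using LRC md by (simp add: k_optimal_LRC_def)
qed

section \<open>Dimensions from a generator matrix\<close>

lemma row_space_eq_range: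
  fixes A :: "'a::field mat"
  assumes "A \<in> carrier_mat k n"
  shows "vec_space.row_space n A = (\<lambda>y. A\<^sup>T *\<^sub>v y) ` carrier_vec k"
  using assms by (auto simp: vec_space.row_space_eq[OF assms])

text \<open>By adjunction between \<open>A\<close> and its transpose, h is orthogonal to the row
  space iff \<open>A *\<^sub>v h\<close> is orthogonal to every vector; testing with unit vectors
  shows that it is then zero.\<close>

lemma dual_row_space_eq_kernel:
  fixes A :: "'a::field mat"
  assumes A: "A \<in> carrier_mat k n"
  shows "dual_code n (vec_space.row_space n A) = {h \<in> carrier_vec n. A *\<^sub>v h = 0\<^sub>v k}"
proof -
  have adj: "h \<bullet> (A\<^sup>T *\<^sub>v y) = (A *\<^sub>v h) \<bullet> y" if "h \<in> carrier_vec n" "y \<in> carrier_vec k" for h y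
  proof -
    have "h \<bullet> (A\<^sup>T *\<^sub>v y) = (A\<^sup>T *\<^sub>v y) \<bullet> h"
      using that A by (intro comm_scalar_prod[where n = n]) auto
    also have "\<dots> = y \<bullet> (A *\<^sub>v h)"
      using transpose_vec_mult_scalar[OF A that] .
    also have "\<dots> = (A *\<^sub>v h) \<bullet> y"
      using that A by (intro comm_scalar_prod[where n = k]) auto
    finally show ?thesis .
  qed
  have "(\<forall>y\<in>carrier_vec k. w \<bullet> y = 0) \<longleftrightarrow> w = 0\<^sub>v k" if w: "w \<in> carrier_vec k" for w :: "'a vec"
  proof
    assume *: "\<forall>y\<in>carrier_vec k. w \<bullet> y = 0"
    show "w = 0\<^sub>v k"
    proof (rule eq_vecI)
      fix i assume "i < dim_vec (0\<^sub>v k :: 'a vec)"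
      then show "w $ i = 0\<^sub>v k $ i"
        using *[rule_format, of "unit_vec k i"] w by (simp add: scalar_prod_right_unit)
    qed (use w in simp)
  qed auto
  then show ?thesis
    unfolding dual_code_altdef row_space_eq_range[OF A] using adj A by auto
qed

lemma mult_mat_linear_map:
  fixes A :: "'a::field mat"
  assumes A: "A \<in> carrier_mat k n"
  shows "linear_map class_ring (module_vec TYPE('a) n) (module_vec TYPE('a) k) (\<lambda>x. A *\<^sub>v x)"
proof -
  have "mod_hom class_ring (module_vec TYPE('a) n) (module_vec TYPE('a) k) (\<lambda>x. A *\<^sub>v x)"
    unfolding mod_hom_def mod_hom_axioms_def LinearCombinations.module_hom_def using A
    by (auto simp: vec_module module_vec_simps class_ring_simps mult_add_distrib_mat_vec mult_mat_vec)
  then show ?thesis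
    by (simp add: linear_map_def vec_vs)
qed

text \<open>Rank-nullity with image and kernel as plain sets of vectors; it is applied to the
  identity, to a generator matrix and to its transpose.\<close>

lemma rank_nullity_mat:
  fixes A :: "'a::field mat"
  assumes A: "A \<in> carrier_mat k n"
  shows "code_dim k ((\<lambda>x. A *\<^sub>v x) ` carrier_vec n) + code_dim n {x \<in> carrier_vec n. A *\<^sub>v x = 0\<^sub>v k} = n"
proof -
  interpret linear_map class_ring "module_vec TYPE('a) n" "module_vec TYPE('a) k" "\<lambda>x. A *\<^sub>v x"
    by (rule mult_mat_linear_map[OF A])
  interpret N: vec_space "TYPE('a)" n .
  have "im = (\<lambda>x. A *\<^sub>v x) ` carrier_vec n" "ker = {x \<in> carrier_vec n. A *\<^sub>v x = 0\<^sub>v k}"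
    by (auto simp: im_def ker_def module_vec_simps)
  then show ?thesis
    using rank_nullity[OF N.fin_dim] by (simp add: code_dim_def N.dim_is_n)
qed

lemma code_dim_carrier: "code_dim n (carrier_vec n :: 'a::field vec set) = n"
proof -
  interpret N: vec_space "TYPE('a)" n .
  have "(module_vec TYPE('a) n)\<lparr>carrier := carrier_vec n\<rparr> = module_vec TYPE('a) n"
    by (simp add: module_vec_def)
  then show ?thesis by (simp only: code_dim_def N.dim_is_n)
qed

text \<open>The zero space is the kernel of the identity matrix, whose image has full
  dimension.\<close>

lemma code_dim_zero: "code_dim n {0\<^sub>v n :: 'a::field vec} = 0"
proof -
  have "(\<lambda>x. 1\<^sub>m n *\<^sub>v x) ` carrier_vec n = (carrier_vec n :: 'a vec set)"
    by (simp add: image_def)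
  moreover have "{x \<in> carrier_vec n. 1\<^sub>m n *\<^sub>v x = 0\<^sub>v n} = {0\<^sub>v n :: 'a vec}"
    by auto
  ultimately show ?thesis
    using rank_nullity_mat[of "1\<^sub>m n :: 'a mat" n n] by (simp add: code_dim_carrier)
qed

text \<open>The unit columns make \<open>A\<close> surjective and its transpose injective.\<close>

lemma code_dim_row_space:
  fixes A :: "'a::field mat"
  assumes A: "A \<in> carrier_mat k n"
    and unit: "\<And>j. j < k \<Longrightarrow> \<exists>i<n. col A i = unit_vec k j"
  shows "code_dim n (vec_space.row_space n A) = k"
    and "code_dim n (dual_code n (vec_space.row_space n A)) + k = n"
proof -
  have "{y \<in> carrier_vec k. A\<^sup>T *\<^sub>v y = 0\<^sub>v n} = {0\<^sub>v k}"
  proof (intro subset_antisym subsetI)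
    fix y assume y: "y \<in> {y \<in> carrier_vec k. A\<^sup>T *\<^sub>v y = 0\<^sub>v n}"
    have "y $ j = 0" if j: "j < k" for j
    proof -
      obtain i where i: "i < n" "col A i = unit_vec k j" using unit[OF j] by blast
      have "0 = (A\<^sup>T *\<^sub>v y) $ i" using y i by simp
      also have "\<dots> = unit_vec k j \<bullet> y" using A i by simp
      also have "\<dots> = y $ j" using y j by simp
      finally show ?thesis by simp
    qed
    then show "y \<in> {0\<^sub>v k}" using y by (auto intro: eq_vecI)
  qed (use A in auto)
  then show "code_dim n (vec_space.row_space n A) = k"
    using rank_nullity_mat[of "A\<^sup>T" n k] A by (simp add: row_space_eq_range code_dim_zero)
  have "carrier_vec k \<subseteq> (\<lambda>x. A *\<^sub>v x) ` carrier_vec n"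
  proof -
    have "set (unit_vecs k) \<subseteq> set (cols A)"
    proof
      fix u :: "'a vec" assume "u \<in> set (unit_vecs k)"
      then obtain j where "j < k" "u = unit_vec k j" by (auto simp: unit_vecs_def)
      with unit obtain i where "i < n" "u = col A i" by metis
      then show "u \<in> set (cols A)" using A by (auto simp: cols_def)
    qed
    interpret K: vec_space "TYPE('a)" k .
    have "carrier_vec k \<subseteq> K.span (set (cols A))"
      using K.span_is_monotone[OF \<open>set (unit_vecs k) \<subseteq> set (cols A)\<close>] K.span_unit_vecs_is_carrier
      by simp
    also have "\<dots> \<subseteq> (\<lambda>x. A *\<^sub>v x) ` carrier_vec n"
      using K.col_space_eq[OF A] A unfolding K.col_space_def by auto
    finally show ?thesis .
  qed
  then have "(\<lambda>x. A *\<^sub>v x) ` carrier_vec n = carrier_vec k" using A by auto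
  then show "code_dim n (dual_code n (vec_space.row_space n A)) + k = n"
    using rank_nullity_mat[OF A] by (simp add: dual_row_space_eq_kernel[OF A] code_dim_carrier)
qed

section \<open>The columns as points of the projective plane\<close>

text \<open>The characteristic divides the cardinality, so \<open>2 ^ m = 0\<close> in the field,
  which has no nonzero nilpotents.\<close>

lemma char_two_if_card_power_two:
  assumes "CARD('a::{field,finite}) = 2 ^ m"
  shows "(2 :: 'a) = 0"
proof -
  have "(of_nat CARD('a) :: 'a) = 0"
    using CHAR_dvd_CARD[where ?'a = 'a] by (simp only: of_nat_eq_0_iff_char_dvd)
  then show ?thesis using assms by simp
qed

text \<open>Multiplication by x permutes the nonzero elements; comparing their products gives
  \<open>x ^ (q - 1) = 1\<close>. This turns the factor \<open>x ^ (q - 2)\<close> of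
  \<open>o_poly_quotient\<close> into division by x.\<close>

lemma power_card_minus_two:
  fixes x :: "'a::{field,finite}"
  assumes "x \<noteq> 0"
  shows "x ^ (CARD('a) - 2) = inverse x"
proof -
  have "bij_betw (\<lambda>y. x * y) (UNIV - {0}) (UNIV - {0})"
    using assms by (intro bij_betwI[of _ _ _ "\<lambda>y. y / x"]) auto
  then have "(\<Prod>y\<in>UNIV - {0}. x * y) = \<Prod>(UNIV - {0})"
    by (rule prod.reindex_bij_betw)
  then have "x ^ (CARD('a) - 1) * \<Prod>(UNIV - {0}) = \<Prod>(UNIV - {0})"
    by (simp add: prod.distrib card_Diff_singleton)
  moreover have "\<Prod>(UNIV - {0 :: 'a}) \<noteq> 0" by simp
  ultimately have "x ^ (CARD('a) - 1) = 1" by simp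
  \<comment> \<open>With at least two elements the truncated subtraction q - 2 is a true
    one.\<close>
  moreover have "card {0, 1 :: 'a} \<le> CARD('a)" by (intro card_mono) auto
  then have "CARD('a) - 1 = Suc (CARD('a) - 2)" by simp
  ultimately have "x * x ^ (CARD('a) - 2) = 1" by simp
  then show ?thesis using inverse_unique by metis
qed

text \<open>The linear form with coefficients (a, b, c) at a point: an entry of a codeword, and zero
  exactly when the point is on the line.\<close>

fun dot3 :: "'a::comm_ring_1 \<times> 'a \<times> 'a \<Rightarrow> 'a \<times> 'a \<times> 'a \<Rightarrow> 'a" where
  "dot3 (a, b, c) (x, y, z) = a * x + b * y + c * z"

text \<open>The hypothesis \<open>q = 2 ^ m\<close> enters as \<open>char2\<close>, and q itself is
  written \<open>CARD('a)\<close>.\<close>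

locale o_poly_points =
  fixes f :: "'a::{field,finite} poly" and v :: 'a and \<alpha> :: "nat \<Rightarrow> 'a"
  assumes char2: "(2 :: 'a) = 0"
    and o_poly: "o_polynomial f"
    and v_avoids: "poly f x + x \<noteq> v"
    and \<alpha>_bij: "bij_betw \<alpha> {1..CARD('a)} UNIV"
begin

definition hyperoval :: "('a \<times> 'a \<times> 'a) set" where
  "hyperoval = range (\<lambda>x. (poly f x, x, 1)) \<union> {(1, 0, 0), (0, 1, 0)}"

definition extra :: "('a \<times> 'a \<times> 'a) set" where
  "extra = {(1, 1, 0), (0, v, 1), (v, 0, 1)}"

text \<open>A list, since its order fixes the coordinates of the code.\<close>

definition columns :: "('a \<times> 'a \<times> 'a) list" where
  "columns = map (\<lambda>i. (poly f (\<alpha> i), \<alpha> i, 1)) [1..<CARD('a) + 1] @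
     [(1, 0, 0), (0, 1, 0), (1, 1, 0), (0, v, 1), (v, 0, 1)]"

abbreviation points :: "('a \<times> 'a \<times> 'a) set" where "points \<equiv> hyperoval \<union> extra"

text \<open>The zero triple gives the set of all triples, so the counting lemmas below assume a
  nonzero argument.\<close>

abbreviation line :: "'a \<times> 'a \<times> 'a \<Rightarrow> ('a \<times> 'a \<times> 'a) set" where
  "line u \<equiv> {P. dot3 u P = 0}"

lemma f_0: "poly f 0 = 0" and inj_f: "inj (poly f)"
  using o_poly by (auto simp: o_polynomial_def permutation_poly_def bij_is_inj)

lemma f_eq_0: "poly f x = 0 \<longleftrightarrow> x = 0"
  using inj_f f_0 by (metis injD)

lemma v_nonzero: "v \<noteq> 0"
  using v_avoids[of 0] by (simp add: f_0)

lemma add_self: "x + x = (0 :: 'a)"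
  by (simp only: mult_2[symmetric] char2 mult_zero_left)

lemma uminus_eq: "- x = (x :: 'a)"
  by (rule minus_unique) (rule add_self)

text \<open>The usual form in which characteristic two is applied: vanishing sums become
  equalities.\<close>

lemma add_eq_0: "x + y = 0 \<longleftrightarrow> x = (y :: 'a)"
  by (simp only: add_eq_0_iff2 uminus_eq)

section \<open>Slopes of chords of the graph of f\<close>

lemma o_poly_quotient_eval:
  "poly (o_poly_quotient f a) x = (if x = 0 then 0 else (poly f (x + a) + poly f a) / x)"
proof (cases "x = 0")
  \<comment> \<open>The numerator f(a) + f(a) vanishes; this covers q = 2, where the factor
    \<open>x ^ 0\<close> is 1.\<close>
  case True
  then show ?thesis
    by (simp add: o_poly_quotient_def poly_pcompose add_self)
next
  case False
  then show ?thesis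
    by (simp add: o_poly_quotient_def poly_pcompose poly_monom power_card_minus_two
        divide_inverse add.commute)
qed

lemma bij_quotient: "bij (poly (o_poly_quotient f a))"
  using o_poly by (simp add: o_polynomial_def permutation_poly_def)

text \<open>At x \<noteq> 0 the quotient polynomial gives the slope of the chord from a to x + a;
  being a permutation, it does not repeat a slope.\<close>

lemma chord_slopes_distinct:
  assumes "b \<noteq> a" "c \<noteq> a" "poly f b + poly f a = s * (b + a)" "poly f c + poly f a = s * (c + a)"
  shows "b = c"
proof -
  \<comment> \<open>Adding a twice cancels, so evaluation at d + a gives the slope of the chord from
    a to d.\<close>
  have *: "poly (o_poly_quotient f a) (d + a) = s"
    if "d \<noteq> a" "poly f d + poly f a = s * (d + a)" for d
  proof -
    have "d + a \<noteq> 0" using that(1) by (simp add: add_eq_0)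
    then have "poly (o_poly_quotient f a) (d + a) = (poly f (d + a + a) + poly f a) / (d + a)"
      by (simp only: o_poly_quotient_eval if_False)
    also have "d + a + a = d" by (simp only: add.assoc add_self add_0_right)
    finally show ?thesis using \<open>d + a \<noteq> 0\<close> that(2) by simp
  qed
  have "poly (o_poly_quotient f a) (b + a) = poly (o_poly_quotient f a) (c + a)"
    using *[OF assms(1,3)] *[OF assms(2,4)] by simp
  then have "b + a = c + a"
    using bij_is_inj[OF bij_quotient] by (metis injD)
  then show ?thesis by simp
qed

text \<open>Surjectivity of the quotient polynomial attains slope 1, and not at 0, where its value
  is 0. Slope 1 is the direction of the extra point (1, 1, 0).\<close>

lemma ex_chord_slope_one: "\<exists>b. b \<noteq> a \<and> poly f a + poly f b = a + b"
proof -
  obtain x where x: "poly (o_poly_quotient f a) x = 1"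
    using bij_is_surj[OF bij_quotient] by (metis surjD)
  then have "x \<noteq> 0" "poly f (x + a) + poly f a = x"
    by (auto simp: o_poly_quotient_eval split: if_splits)
  moreover have "a + (x + a) = x"
    using add_self[of a] by (metis add.assoc add.commute add.right_neutral)
  ultimately show ?thesis
    by (intro exI[of _ "x + a"]) (simp add: add.commute)
qed

section \<open>Lines meeting the hyperoval and the extra points\<close>

lemma card_le_2: "X \<subseteq> {u, w} \<Longrightarrow> card X \<le> 2"
  using card_mono[of "{u, w}" X] card_length[of "[u, w]"] by simp

text \<open>The point (1, 0, 0) is on the line iff a = 0, and (0, 1, 0) iff b = 0. With both on it
  there is no graph point; with one of them, at most one graph point; with neither, at most two, by
  distinctness of chord slopes.\<close>

lemma card_hyperoval_line:
  assumes "(a, b, c) \<noteq> (0, 0, 0)"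
  shows "card (hyperoval \<inter> line (a, b, c)) \<le> 2"
proof -
  let ?p = "\<lambda>x. (poly f x, x, 1 :: 'a)"
  have "\<exists>u w. hyperoval \<inter> line (a, b, c) \<subseteq> {u, w}"
  proof (cases "a = 0")
    case a: True
    show ?thesis
    proof (cases "b = 0")
      case True
      then have "hyperoval \<inter> line (a, b, c) \<subseteq> {(1, 0, 0), (0, 1, 0)}"
        using a assms by (auto simp: hyperoval_def)
      then show ?thesis by blast
    next
      case False
      then have "x = c / b" if "b * x + c = 0" for x
        using that by (simp add: add_eq_0 field_simps)
      then have "hyperoval \<inter> line (a, b, c) \<subseteq> {?p (c / b), (1, 0, 0)}"
        using a False by (auto simp: hyperoval_def)
      then show ?thesis by blast
    qed
  next
    case a: False
    show ?thesis
    proof (cases "b = 0")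
      case True
      have "x = y" if "a * poly f x + c = 0" "a * poly f y + c = 0" for x y
      proof -
        have "a * poly f x = a * poly f y" using that by (simp add: add_eq_0)
        then show ?thesis using a inj_f by (simp add: inj_eq)
      qed
      \<comment> \<open>Any x serves if the equation has no solution.\<close>
      then have "\<exists>x. \<forall>y. a * poly f y + c = 0 \<longrightarrow> y = x" by blast
      then obtain x where "\<forall>y. a * poly f y + c = 0 \<longrightarrow> y = x" by blast
      then have "hyperoval \<inter> line (a, b, c) \<subseteq> {?p x, (0, 1, 0)}"
        using a True by (auto simp: hyperoval_def)
      then show ?thesis by blast
    next
      case b: False
      then have affine: "P \<in> ?p ` {x. a * poly f x + b * x + c = 0}"
        if "P \<in> hyperoval \<inter> line (a, b, c)" for P
        using that a by (auto simp: hyperoval_def)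
      show ?thesis
      proof (cases "\<exists>x. a * poly f x + b * x + c = 0")
        case False
        then have "hyperoval \<inter> line (a, b, c) \<subseteq> {}" using affine by blast
        then show ?thesis by blast
      next
        case True
        then obtain x where x: "a * poly f x + b * x + c = 0" by blast
        \<comment> \<open>Adding the equations at y and x cancels c: all further graph points on the
          line are joined to that of x by chords of the same slope b / a.\<close>
        have slope: "poly f y + poly f x = b / a * (y + x)" if "a * poly f y + b * y + c = 0" for y
        proof -
          have "(a * poly f y + b * y + c) + (a * poly f x + b * x + c)
              = (a * (poly f y + poly f x) + b * (y + x)) + (c + c)"
            by (simp add: algebra_simps)
          then have "a * (poly f y + poly f x) + b * (y + x) = 0"
            using x that by (simp add: add_self)
          then have "a * (poly f y + poly f x) = b * (y + x)" by (simp add: add_eq_0)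
          then show ?thesis using a by (simp add: field_simps)
        qed
        have "y = z" if "a * poly f y + b * y + c = 0" "a * poly f z + b * z + c = 0" "y \<noteq> x" "z \<noteq> x" for y z
          using chord_slopes_distinct[OF that(3,4) slope[OF that(1)] slope[OF that(2)]] .
        then have "\<exists>w. \<forall>y. a * poly f y + b * y + c = 0 \<longrightarrow> y = x \<or> y = w" by metis
        then obtain w where "\<forall>y. a * poly f y + b * y + c = 0 \<longrightarrow> y = x \<or> y = w" by blast
        then have "hyperoval \<inter> line (a, b, c) \<subseteq> {?p x, ?p w}"
          using affine by blast
        then show ?thesis by blast
      qed
    qed
  qed
  then obtain P Q where "hyperoval \<inter> line (a, b, c) \<subseteq> {P, Q}" by (elim exE)
  then show ?thesis by (rule card_le_2)
qed

lemma card_points_line: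
  assumes "u \<noteq> (0, 0, 0)"
  shows "card (points \<inter> line u) \<le> 3"
proof -
  obtain a b c where u: "u = (a, b, c)" by (cases u)
  have "points \<inter> line u = (hyperoval \<inter> line u) \<union> (extra \<inter> line u)" by blast
  then have le: "card (points \<inter> line u) \<le> card (hyperoval \<inter> line u) + card (extra \<inter> line u)"
    by (simp add: card_Un_le)
  show ?thesis
  \<comment> \<open>The condition says that u is a multiple of (1, 1, v), the line of the extra
    points. The bound is 0 + 3 on it and 2 + 1 on all others.\<close>
  proof (cases "b = a \<and> c = a * v")
    case True
    then have a: "a \<noteq> 0" using assms u by auto
    have "a * poly f x + b * x + c \<noteq> 0" for x
    proof -
      have "a * poly f x + b * x + c = a * ((poly f x + x) + v)"
        using True by (simp add: algebra_simps)
      then show ?thesis using a v_avoids[of x] by (simp add: add_eq_0)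
    qed
    then have "hyperoval \<inter> line u = {}"
      using True a by (auto simp: hyperoval_def u)
    moreover have "card (extra \<inter> line u) \<le> card {(1, 1, 0), (0, v, 1), (v, 0, 1 :: 'a)}"
      unfolding extra_def by (intro card_mono) auto
    ultimately show ?thesis
      using le card_length[of "[(1, 1, 0), (0, v, 1), (v, 0, 1 :: 'a)]"] by simp
  next
    case False
    \<comment> \<open>As v \<noteq> 0, any two of a + b = 0, b v + c = 0 and a v + c = 0 would force
      b = a and c = a v.\<close>
    have "\<exists>P. extra \<inter> line u \<subseteq> {P}"
    proof -
      have 1: "a + b = 0 \<longleftrightarrow> b = a" using add_eq_0 by metis
      have 2: "b * v + c = 0 \<longleftrightarrow> c = b * v" "a * v + c = 0 \<longleftrightarrow> c = a * v" using add_eq_0 by metis+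
      have 3: "b * v + a * v = 0 \<longleftrightarrow> b = a" using v_nonzero add_eq_0[of "b * v"] by simp
      show ?thesis
      proof (cases "b = a")
        case True
        then have "extra \<inter> line u \<subseteq> {(1, 1, 0)}"
          using False by (auto simp: extra_def u 2)
        then show ?thesis by blast
      next
        case ba: False
        show ?thesis
        proof (cases "c = a * v")
          case True
          then have "extra \<inter> line u \<subseteq> {(v, 0, 1)}"
            using ba 3 by (auto simp: extra_def u 1 2)
          then show ?thesis by blast
        next
          case False
          then have "extra \<inter> line u \<subseteq> {(0, v, 1)}"
            using ba by (auto simp: extra_def u 1 2)
          then show ?thesis by blast
        qed
      qed
    qed
    then obtain P where "extra \<inter> line u \<subseteq> {P}" by blast
    then have "card (extra \<inter> line u) \<le> card {P}" by (intro card_mono) auto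
    moreover have "card (hyperoval \<inter> line u) \<le> 2"
      using card_hyperoval_line assms unfolding u by blast
    ultimately show ?thesis using le by simp
  qed
qed

text \<open>Every point is normalised: its last nonzero coordinate is \<open>1\<close>.\<close>

lemma points_independent:
  assumes "(x, y, z) \<in> points" "(x', y', z') \<in> points" "s \<noteq> 0"
    and "s * x + t * x' = 0" "s * y + t * y' = 0" "s * z + t * z' = 0"
  shows "(x, y, z) = (x', y', z')"
proof -
  have norm: "z = 1 \<or> z = 0 \<and> (y = 1 \<or> y = 0 \<and> x = 1)" if "(x, y, z) \<in> points" for x y z
    using that by (auto simp: hyperoval_def extra_def)
  have eqs: "s * x = t * x'" "s * y = t * y'" "s * z = t * z'"
    using assms(4-6) by (simp_all add: add_eq_0)
  \<comment> \<open>Since s \<noteq> 0, the last nonzero coordinates are in the same position, and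
    both are 1.\<close>
  have "s = t"
    using norm[OF assms(1)] norm[OF assms(2)] eqs assms(3) by auto
  then show ?thesis using eqs assms(3) by simp
qed

section \<open>Columns, generator matrix and codewords\<close>

lemma set_columns: "set columns = points"
proof -
  have "set [1..<CARD('a) + 1] = {1..CARD('a)}" by auto
  then have image: "\<alpha> ` set [1..<CARD('a) + 1] = UNIV" using \<alpha>_bij by (simp add: bij_betw_def)
  have "(\<lambda>i. (poly f (\<alpha> i), \<alpha> i, 1 :: 'a)) ` set [1..<CARD('a) + 1]
      = (\<lambda>x. (poly f x, x, 1)) ` \<alpha> ` set [1..<CARD('a) + 1]"
    by (simp only: image_image)
  then have "(\<lambda>i. (poly f (\<alpha> i), \<alpha> i, 1 :: 'a)) ` set [1..<CARD('a) + 1]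
      = range (\<lambda>x. (poly f x, x, 1))"
    by (simp only: image)
  then show ?thesis
    unfolding columns_def hyperoval_def extra_def set_append set_map by auto
qed

text \<open>Injectivity of \<alpha> separates the graph points. Neither (0, v, 1) nor (v, 0, 1) is
  on the graph, because f vanishes only at 0 and v \<noteq> 0.\<close>

lemma distinct_columns: "distinct columns"
proof -
  have "set [1..<CARD('a) + 1] = {1..CARD('a)}" by auto
  then have inj: "inj_on \<alpha> (set [1..<CARD('a) + 1])"
    using \<alpha>_bij by (simp only: bij_betw_def)
  have "inj_on (\<lambda>i. (poly f (\<alpha> i), \<alpha> i, 1 :: 'a)) (set [1..<CARD('a) + 1])"
    by (rule inj_onI, rule inj_onD[OF inj]) (simp_all only: prod.inject)
  then have "distinct (map (\<lambda>i. (poly f (\<alpha> i), \<alpha> i, 1 :: 'a)) [1..<CARD('a) + 1])" (is "distinct ?xs")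
    by (simp only: distinct_map distinct_upt)
  moreover have "distinct [(1, 0, 0), (0, 1, 0), (1, 1, 0), (0, v, 1), (v, 0, 1 :: 'a)]"
    using v_nonzero by simp
  moreover have "set ?xs \<inter> set [(1, 0, 0), (0, 1, 0), (1, 1, 0), (0, v, 1), (v, 0, 1 :: 'a)] = {}"
    using v_nonzero by (auto simp: f_eq_0 f_0 simp del: upt_Suc)
  ultimately show ?thesis
    by (simp only: columns_def distinct_append)
qed

lemma length_columns: "length columns = CARD('a) + 5"
  unfolding columns_def by (simp del: upt_Suc)

lemma bij_nth_columns: "bij_betw ((!) columns) {..<CARD('a) + 5} points"
  by (rule bij_betw_nth) (simp_all only: distinct_columns set_columns length_columns)

text \<open>The message u is read as a line: the zero entries of \<open>word u\<close> are the
  columns on \<open>line u\<close>.\<close>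

definition word :: "'a \<times> 'a \<times> 'a \<Rightarrow> 'a vec" where
  "word u = vec (CARD('a) + 5) (\<lambda>i. dot3 u (columns ! i))"

lemma gen_matrix_carrier: "gen_matrix f \<alpha> v \<in> carrier_mat 3 (CARD('a) + 5)"
  unfolding gen_matrix_def mat_of_rows_list_def
  by (rule carrier_matI) (simp_all only: dim_row_mat dim_col_mat list.size)

lemma nth_columns: "i < CARD('a) + 5 \<Longrightarrow> columns ! i =
    (gen_matrix f \<alpha> v $$ (0, i), gen_matrix f \<alpha> v $$ (1, i), gen_matrix f \<alpha> v $$ (2, i))"
proof -
  assume i: "i < CARD('a) + 5"
  have index: "mat_of_rows_list (CARD('a) + 5) rs $$ (j, i) = rs ! j ! i" if "j < length rs" for rs :: "'a list list" and j
    using i that by (simp add: mat_of_rows_list_def)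
  have G: "gen_matrix f \<alpha> v $$ (0, i) = (map (\<lambda>i. poly f (\<alpha> i)) [1..<CARD('a) + 1] @ [1, 0, 1, 0, v]) ! i"
    "gen_matrix f \<alpha> v $$ (1, i) = (map (\<lambda>i. \<alpha> i) [1..<CARD('a) + 1] @ [0, 1, 1, v, 0]) ! i"
    "gen_matrix f \<alpha> v $$ (2, i) = (map (\<lambda>i. 1) [1..<CARD('a) + 1] @ [0, 0, 0, 1, 1]) ! i"
    unfolding gen_matrix_def by (subst index; simp del: upt_Suc map_append nth_append)+
  show ?thesis
  proof (cases "i < CARD('a)")
    case True
    then show ?thesis unfolding G columns_def nth_append by (simp del: upt_Suc)
  next
    case False
    define j where "j = i - CARD('a)"
    have "i = CARD('a) + j" "j < 5" using i False by (auto simp: j_def)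
    moreover from this have "j \<in> {0, 1, 2, 3, 4}" by auto
    ultimately show ?thesis unfolding G columns_def nth_append by (auto simp del: upt_Suc)
  qed
qed

lemma transpose_gen_matrix_mult:
  assumes "y \<in> carrier_vec 3"
  shows "(gen_matrix f \<alpha> v)\<^sup>T *\<^sub>v y = word (y $ 0, y $ 1, y $ 2)"
proof (rule eq_vecI)
  fix i assume "i < dim_vec (word (y $ 0, y $ 1, y $ 2))"
  then have i: "i < CARD('a) + 5" by (simp add: word_def)
  have "{0..<3} = {0, 1, 2 :: nat}" by auto
  then show "((gen_matrix f \<alpha> v)\<^sup>T *\<^sub>v y) $ i = word (y $ 0, y $ 1, y $ 2) $ i"
    using assms i gen_matrix_carrier by (simp add: word_def scalar_prod_def nth_columns algebra_simps)
qed (use gen_matrix_carrier in \<open>simp add: word_def\<close>)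

lemma code_v_eq: "code_v f \<alpha> v = range word"
proof -
  have "code_v f \<alpha> v = (\<lambda>y. word (y $ 0, y $ 1, y $ 2)) ` carrier_vec 3"
    unfolding code_v_def row_space_eq_range[OF gen_matrix_carrier]
    using transpose_gen_matrix_mult by simp
  also have "\<dots> = range word"
  proof -
    have "word (a, b, c) \<in> (\<lambda>y. word (y $ 0, y $ 1, y $ 2)) ` carrier_vec 3" for a b c
      by (rule image_eqI[of _ _ "vec 3 (\<lambda>i. if i = 0 then a else if i = 1 then b else c)"]) auto
    then show ?thesis by auto
  qed
  finally show ?thesis .
qed

section \<open>Weights and optimality\<close>

abbreviation C where "C \<equiv> code_v f \<alpha> v"

abbreviation C_dual where "C_dual \<equiv> dual_code (CARD('a) + 5) C"

lemma card_points: "card points = CARD('a) + 5"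
  using distinct_card[OF distinct_columns] by (simp only: set_columns length_columns)

lemma finite_points: "finite points"
  by (metis List.finite_set set_columns)

lemma ex_column:
  assumes "P \<in> points"
  obtains i where "i < CARD('a) + 5" "columns ! i = P"
  using assms unfolding set_columns[symmetric] in_set_conv_nth length_columns by blast

lemma column_in_points: "i < CARD('a) + 5 \<Longrightarrow> columns ! i \<in> points"
  using bij_betwE[OF bij_nth_columns] by blast

text \<open>Turns supports of codewords and of dual words into sets of points.\<close>

lemma card_column_indices:
  "card {i. i < CARD('a) + 5 \<and> Q (columns ! i)} = card {P \<in> points. Q P}"
proof (rule bij_betw_same_card)
  show "bij_betw ((!) columns) {i. i < CARD('a) + 5 \<and> Q (columns ! i)} {P \<in> points. Q P}"
  proof (rule bij_betw_imageI)
    show "inj_on ((!) columns) {i. i < CARD('a) + 5 \<and> Q (columns ! i)}"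
      by (rule inj_on_subset[OF bij_betw_imp_inj_on[OF bij_nth_columns]]) auto
    show "(!) columns ` {i. i < CARD('a) + 5 \<and> Q (columns ! i)} = {P \<in> points. Q P}"
    proof (intro subset_antisym subsetI)
      fix P assume P: "P \<in> {P \<in> points. Q P}"
      then obtain i where "i < CARD('a) + 5" "columns ! i = P" using ex_column by blast
      then show "P \<in> (!) columns ` {i. i < CARD('a) + 5 \<and> Q (columns ! i)}" using P by blast
    qed (use column_in_points in blast)
  qed
qed

lemma hamming_weight_word: "hamming_weight (word u) = CARD('a) + 5 - card (points \<inter> line u)"
proof -
  have "hamming_weight (word u) = card {i. i < CARD('a) + 5 \<and> dot3 u (columns ! i) \<noteq> 0}"
    by (simp add: hamming_weight_def word_def cong: conj_cong)
  also have "\<dots> = card (points - line u)"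
    unfolding card_column_indices[of "\<lambda>P. dot3 u P \<noteq> 0"]
    by (rule arg_cong[where f = card]) blast
  also have "\<dots> = CARD('a) + 5 - card (points \<inter> line u)"
    unfolding card_points[symmetric]
    by (rule card_Diff_subset_Int) (use finite_points in blast)
  finally show ?thesis .
qed

text \<open>The column (0, 0, 1) is the graph point at x = 0, as f(0) = 0; the other two unit
  vectors are the hyperoval points at infinity.\<close>

lemma gen_matrix_unit_columns:
  assumes "j < 3"
  shows "\<exists>i<CARD('a) + 5. col (gen_matrix f \<alpha> v) i = unit_vec 3 j"
proof -
  define P :: "'a \<times> 'a \<times> 'a" where "P = (if j = 0 then 1 else 0, if j = 1 then 1 else 0, if j = 2 then 1 else 0)"
  have j: "j = 0 \<or> j = 1 \<or> j = 2" using assms by auto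
  have "(0, 0, 1) = (poly f 0, 0, 1 :: 'a)" by (simp add: f_0)
  then have "P \<in> points" using j by (auto simp: P_def hyperoval_def)
  then obtain i where i: "i < CARD('a) + 5" "columns ! i = P" by (rule ex_column)
  have "gen_matrix f \<alpha> v $$ (k, i) = (if k = j then 1 else 0)" if "k < 3" for k
  proof -
    have "k = 0 \<or> k = 1 \<or> k = 2" using that by auto
    then show ?thesis using j nth_columns[OF i(1)] i(2) by (auto simp: P_def)
  qed
  then have "col (gen_matrix f \<alpha> v) i = unit_vec 3 j"
    using gen_matrix_carrier i(1) by (intro eq_vecI) (auto simp: unit_vec_def)
  then show ?thesis using i(1) by blast
qed

lemma code_dims:
  shows "code_dim (CARD('a) + 5) C = 3"
    and "code_dim (CARD('a) + 5) C_dual = CARD('a) + 2"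
  using code_dim_row_space[OF gen_matrix_carrier gen_matrix_unit_columns]
  unfolding code_v_def by simp_all

lemma code_v_subset: "C \<subseteq> carrier_vec (CARD('a) + 5)"
  by (auto simp: code_v_eq word_def)

lemma linear_code_v: "linear_code (CARD('a) + 5) C"
proof -
  have lin: "dot3 (a, b, c) P + dot3 (a', b', c') P = dot3 (a + a', b + b', c + c') P"
    "s * dot3 (a, b, c) P = dot3 (s * a, s * b, s * c) P" "dot3 (0, 0, 0) P = 0"
    for a b c a' b' c' s :: 'a and P
    by (cases P; simp add: algebra_simps)+
  have "word (a, b, c) + word (a', b', c') = word (a + a', b + b', c + c')" for a b c a' b' c'
    by (rule eq_vecI) (simp_all add: word_def lin)
  moreover have "s \<cdot>\<^sub>v word (a, b, c) = word (s * a, s * b, s * c)" for s a b c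
    by (rule eq_vecI) (simp_all add: word_def lin)
  moreover have "0\<^sub>v (CARD('a) + 5) = word (0, 0, 0)"
    by (rule eq_vecI) (simp_all add: word_def lin)
  ultimately show ?thesis
    using code_v_subset unfolding linear_code_iff code_v_eq by (auto intro: rangeI)
qed

section \<open>Lines with three columns and low-weight codewords\<close>

lemma low_weight_word:
  assumes "P \<noteq> Q" "P \<noteq> R" "Q \<noteq> R" "{P, Q, R} \<subseteq> points \<inter> line u"
  shows "hamming_weight (word u) \<le> CARD('a) + 2"
proof -
  have "card {P, Q, R} \<le> card (points \<inter> line u)"
    using assms(4) finite_points by (intro card_mono) simp_all
  then show ?thesis using assms(1-3) by (simp add: hamming_weight_word)
qed

lemma points_members:
  "(1, 0, 0) \<in> points" "(0, 1, 0) \<in> points" "(1, 1, 0) \<in> points" "(0, v, 1) \<in> points"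
  "(v, 0, 1) \<in> points" "(0, 0, 1) \<in> points" "(poly f x, x, 1) \<in> points"
proof -
  have "(0, 0, 1) = (poly f 0, 0, 1 :: 'a)" by (simp add: f_0)
  then show "(0, 0, 1) \<in> points" by (auto simp: hyperoval_def)
qed (simp_all add: hyperoval_def extra_def)

lemma points_cases:
  assumes "P \<in> points"
  obtains x where "P = (poly f x, x, 1)" | "P = (1, 0, 0)" | "P = (0, 1, 0)" | "P = (1, 1, 0)"
    | "P = (0, v, 1)" | "P = (v, 0, 1)"
  using assms by (auto simp: hyperoval_def extra_def)

text \<open>The lines Z = 0, X = 0 and X + Y = vZ. The first two meet in (0, 1, 0), which is off the
  third, so every point is off at least one of them.\<close>

lemma three_secants:
  "hamming_weight (word (0, 0, 1)) \<le> CARD('a) + 2"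
  "hamming_weight (word (1, 0, 0)) \<le> CARD('a) + 2"
  "hamming_weight (word (1, 1, v)) \<le> CARD('a) + 2"
  using low_weight_word[of "(1, 0, 0)" "(0, 1, 0)" "(1, 1, 0)" "(0, 0, 1)"]
    low_weight_word[of "(0, 0, 1)" "(0, 1, 0)" "(0, v, 1)" "(1, 0, 0)"]
    low_weight_word[of "(1, 1, 0)" "(0, v, 1)" "(v, 0, 1)" "(1, 1, v)"]
    points_members v_nonzero
  by (simp_all add: add_self)

text \<open>A coordinate is nonzero in \<open>word u\<close> when its column is off
  \<open>line u\<close>. These words witness the minimum weight and serve as parity checks of the
  dual.\<close>

lemma word_cover:
  assumes i: "i < CARD('a) + 5"
  shows "\<exists>c\<in>C. c $ i \<noteq> 0 \<and> hamming_weight c \<le> CARD('a) + 2"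
proof -
  have "\<exists>u. dot3 u (columns ! i) \<noteq> 0 \<and> hamming_weight (word u) \<le> CARD('a) + 2"
    using column_in_points[OF i]
  proof (cases rule: points_cases)
    case (1 x)
    then show ?thesis using three_secants(1) by (intro exI[of _ "(0, 0, 1)"]) simp
  next
    case 2
    then show ?thesis using three_secants(2) by (intro exI[of _ "(1, 0, 0)"]) simp
  next
    case 3
    then show ?thesis using three_secants(3) by (intro exI[of _ "(1, 1, v)"]) simp
  next
    case 4
    then show ?thesis using three_secants(2) by (intro exI[of _ "(1, 0, 0)"]) simp
  next
    case 5
    then show ?thesis using three_secants(1) by (intro exI[of _ "(0, 0, 1)"]) simp
  next
    case 6
    then show ?thesis using three_secants(1) by (intro exI[of _ "(0, 0, 1)"]) simp
  qed
  then show ?thesis using i by (auto simp: code_v_eq word_def)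
qed

lemma min_weight_code_v: "min_weight (CARD('a) + 5) C = CARD('a) + 2"
proof -
  obtain c where c: "c \<in> C" "c $ 0 \<noteq> 0" "hamming_weight c \<le> CARD('a) + 2"
    using word_cover[of 0] by auto
  have "c \<noteq> 0\<^sub>v (CARD('a) + 5)" using c(2) by auto
  moreover have "CARD('a) + 2 \<le> hamming_weight w" if w: "w \<in> C" "w \<noteq> 0\<^sub>v (CARD('a) + 5)" for w
  proof -
    obtain u where u: "w = word u" using w(1) by (auto simp: code_v_eq)
    have "dot3 (0, 0, 0) P = (0 :: 'a)" for P by (cases P) simp
    then have "word (0, 0, 0) = 0\<^sub>v (CARD('a) + 5)"
      by (intro eq_vecI) (simp_all add: word_def)
    then have "u \<noteq> (0, 0, 0)" using w(2) u by auto
    from card_points_line[OF this] show ?thesis by (simp add: u hamming_weight_word)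
  qed
  ultimately show ?thesis
    using min_weight_eqI[OF code_v_subset c(1) _ c(3)] by blast
qed

section \<open>Low-weight words of the dual code\<close>

lemma dual_word_of_dependency:
  assumes i: "i < CARD('a) + 5" "columns ! i = P"
    and PQR: "P \<noteq> Q" "P \<noteq> R" "Q \<noteq> R" "{P, Q, R} \<subseteq> points"
    and dep: "\<And>u. dot3 u P + dot3 u Q + t * dot3 u R = 0"
  shows "\<exists>h\<in>C_dual. h $ i \<noteq> 0 \<and> hamming_weight h \<le> 3"
proof -
  \<comment> \<open>The coefficients of the dependency, placed at the three columns, form a dual
    word with entry 1 at index i; the forms u run through all codewords.\<close>
  define w where "w = (\<lambda>X. if X = P then 1 else if X = Q then 1 else if X = R then t else 0)"
  define h where "h = vec (CARD('a) + 5) (\<lambda>i. w (columns ! i))"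
  have "h \<bullet> word u = 0" for u
  proof -
    have "h \<bullet> word u = (\<Sum>i<CARD('a) + 5. w (columns ! i) * dot3 u (columns ! i))"
      by (simp add: h_def word_def scalar_prod_def atLeast0LessThan)
    also have "\<dots> = (\<Sum>X\<in>points. w X * dot3 u X)"
      by (rule sum.reindex_bij_betw[OF bij_nth_columns])
    also have "\<dots> = (\<Sum>X\<in>{P, Q, R}. w X * dot3 u X)"
      using PQR(4) finite_points by (intro sum.mono_neutral_right) (auto simp: w_def)
    also have "\<dots> = dot3 u P + dot3 u Q + t * dot3 u R"
      using PQR(1-3) by (simp add: w_def)
    finally show ?thesis by (simp only: dep)
  qed
  then have "h \<in> C_dual" by (auto simp: dual_code_altdef code_v_eq h_def)
  moreover have "h $ i \<noteq> 0" using i by (simp add: h_def w_def)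
  moreover have "hamming_weight h = card {X \<in> points. w X \<noteq> 0}"
    unfolding card_column_indices[symmetric]
    by (simp add: hamming_weight_def h_def cong: conj_cong)
  moreover have "card {X \<in> points. w X \<noteq> 0} \<le> card (set [P, Q, R])"
    by (intro card_mono) (auto simp: w_def split: if_splits)
  ultimately show ?thesis using card_length[of "[P, Q, R]"] by force
qed

lemma dual_word_cover:
  assumes i: "i < CARD('a) + 5"
  shows "\<exists>h\<in>C_dual. h $ i \<noteq> 0 \<and> hamming_weight h \<le> 3"
  using column_in_points[OF i]
proof (cases rule: points_cases)
  case (1 x)
  \<comment> \<open>A chord of slope 1 passes through (1, 1, 0): the sum of its two graph points is
    x + y times that point.\<close>
  obtain y where y: "y \<noteq> x" "poly f x + poly f y = x + y" using ex_chord_slope_one by blast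
  have "dot3 u (poly f x, x, 1) + dot3 u (poly f y, y, 1) + (x + y) * dot3 u (1, 1, 0) = 0" for u
  proof (cases u)
    case (fields a b c)
    have "dot3 u (poly f x, x, 1) + dot3 u (poly f y, y, 1) + (x + y) * dot3 u (1, 1, 0)
        = a * ((poly f x + poly f y) + (x + y)) + b * ((x + y) + (x + y)) + (c + c)"
      by (simp add: fields algebra_simps)
    then show ?thesis by (simp only: y(2) add_self mult_zero_right add_0_right)
  qed
  then show ?thesis
    using dual_word_of_dependency[OF i 1, of "(poly f y, y, 1)" "(1, 1, 0)" "x + y"] y(1) points_members
    by simp
next
  case 2
  have "dot3 u (1, 0, 0) + dot3 u (0, 1, 0) + 1 * dot3 u (1, 1, 0) = 0" for u :: "'a \<times> 'a \<times> 'a"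
    by (cases u) (simp add: add_self)
  then show ?thesis
    using dual_word_of_dependency[OF i 2, of "(0, 1, 0)" "(1, 1, 0)" 1] points_members
    by simp
next
  case 3
  have "dot3 u (0, 1, 0) + dot3 u (1, 0, 0) + 1 * dot3 u (1, 1, 0) = 0" for u :: "'a \<times> 'a \<times> 'a"
    by (cases u) (simp add: char2)
  then show ?thesis
    using dual_word_of_dependency[OF i 3, of "(1, 0, 0)" "(1, 1, 0)" 1] points_members
    by simp
next
  case 4
  have "dot3 u (1, 1, 0) + dot3 u (1, 0, 0) + 1 * dot3 u (0, 1, 0) = 0" for u :: "'a \<times> 'a \<times> 'a"
  proof (cases u)
    case (fields a b c)
    then have "dot3 u (1, 1, 0) + dot3 u (1, 0, 0) + 1 * dot3 u (0, 1, 0) = (a + b) + (a + b)" by simp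
    then show ?thesis by (simp only: add_self)
  qed
  then show ?thesis
    using dual_word_of_dependency[OF i 4, of "(1, 0, 0)" "(0, 1, 0)" 1] points_members
    by simp
next
  case 5
  \<comment> \<open>The line X = 0 supplies this triple, and Y = 0 the one for (v, 0, 1).\<close>
  have "dot3 u (0, v, 1) + dot3 u (0, 0, 1) + v * dot3 u (0, 1, 0) = 0" for u
  proof (cases u)
    case (fields a b c)
    then have "dot3 u (0, v, 1) + dot3 u (0, 0, 1) + v * dot3 u (0, 1, 0) = (b * v + c) + (b * v + c)"
      by (simp add: algebra_simps)
    then show ?thesis by (simp only: add_self)
  qed
  then show ?thesis
    using dual_word_of_dependency[OF i 5, of "(0, 0, 1)" "(0, 1, 0)" v] points_members v_nonzero
    by simp
next
  case 6
  have "dot3 u (v, 0, 1) + dot3 u (0, 0, 1) + v * dot3 u (1, 0, 0) = 0" for u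
  proof (cases u)
    case (fields a b c)
    then have "dot3 u (v, 0, 1) + dot3 u (0, 0, 1) + v * dot3 u (1, 0, 0) = (a * v + c) + (a * v + c)"
      by (simp add: algebra_simps)
    then show ?thesis by (simp only: add_self)
  qed
  then show ?thesis
    using dual_word_of_dependency[OF i 6, of "(0, 0, 1)" "(1, 0, 0)" v] points_members v_nonzero
    by simp
qed

text \<open>A nonzero dual word of weight at most 2 would be a dependency between two columns,
  contrary to \<open>points_independent\<close>.\<close>

lemma dual_weight_ge_3:
  assumes h: "h \<in> C_dual" "h \<noteq> 0\<^sub>v (CARD('a) + 5)"
  shows "3 \<le> hamming_weight h"
proof (rule ccontr)
  let ?S = "{i. i < CARD('a) + 5 \<and> h $ i \<noteq> 0}"
  assume small: "\<not> 3 \<le> hamming_weight h"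
  have hn: "h \<in> carrier_vec (CARD('a) + 5)" using h(1) by (simp add: dual_code_altdef)
  have "\<exists>i. i < CARD('a) + 5 \<and> h $ i \<noteq> 0"
  proof (rule ccontr)
    assume "\<not> ?thesis"
    then have "h = 0\<^sub>v (CARD('a) + 5)" using hn by (intro eq_vecI) auto
    with h(2) show False by blast
  qed
  then obtain i where i: "i < CARD('a) + 5" "h $ i \<noteq> 0" by blast
  have "card ?S \<le> 2" using small hn by (simp add: hamming_weight_def)
  then have "card (?S - {i}) \<le> 1" using i by (simp add: card_Diff_singleton)
  then have "\<exists>j. ?S - {i} \<subseteq> {j}"
    using card_le_Suc0_iff_eq[of "?S - {i}"] by (simp, blast)
  \<comment> \<open>If the support is just i, any other index serves as j, with entry 0.\<close>
  moreover have "\<exists>j. j < CARD('a) + 5 \<and> j \<noteq> i" by (rule exI[of _ "if i = 0 then 1 else 0"]) simp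
  ultimately have "\<exists>j. j < CARD('a) + 5 \<and> j \<noteq> i \<and> ?S - {i} \<subseteq> {j}"
    by blast
  then obtain j where j: "j < CARD('a) + 5" "j \<noteq> i" "?S - {i} \<subseteq> {j}" by blast
  have dep: "h $ i * dot3 u (columns ! i) + h $ j * dot3 u (columns ! j) = 0" for u
  proof -
    have "word u \<in> C" by (simp add: code_v_eq)
    then have "0 = h \<bullet> word u" using h(1) by (simp add: dual_code_altdef)
    also have "\<dots> = (\<Sum>l<CARD('a) + 5. h $ l * dot3 u (columns ! l))"
      by (simp add: word_def scalar_prod_def atLeast0LessThan)
    also have "\<dots> = (\<Sum>l\<in>{i, j}. h $ l * dot3 u (columns ! l))"
      using i(1) j by (intro sum.mono_neutral_right) auto
    finally show ?thesis using j(2) by simp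
  qed
  obtain x y z x' y' z' where P: "columns ! i = (x, y, z)" "columns ! j = (x', y', z')"
    by (metis prod_cases3)
  have "columns ! i = columns ! j"
    unfolding P
  proof (rule points_independent[OF _ _ i(2)])
    show "(x, y, z) \<in> points" "(x', y', z') \<in> points"
      using column_in_points i(1) j(1) P by metis+
    \<comment> \<open>The coordinate forms recover the three coordinates of the dependency.\<close>
    show "h $ i * x + h $ j * x' = 0" using dep[of "(1, 0, 0)"] by (simp add: P)
    show "h $ i * y + h $ j * y' = 0" using dep[of "(0, 1, 0)"] by (simp add: P)
    show "h $ i * z + h $ j * z' = 0" using dep[of "(0, 0, 1)"] by (simp add: P)
  qed
  then show False
    using nth_eq_iff_index_eq[OF distinct_columns] i(1) j(1,2) length_columns by metis
qed

lemma min_weight_dual: "min_weight (CARD('a) + 5) C_dual = 3"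
proof -
  obtain h where h: "h \<in> C_dual" "h $ 0 \<noteq> 0" "hamming_weight h \<le> 3"
    using dual_word_cover[of 0] by auto
  have "C_dual \<subseteq> carrier_vec (CARD('a) + 5)" by (auto simp: dual_code_altdef)
  moreover have "h \<noteq> 0\<^sub>v (CARD('a) + 5)" using h(2) by auto
  ultimately show ?thesis
    using min_weight_eqI[OF _ h(1) _ h(3)] dual_weight_ge_3 by blast
qed

section \<open>Parameters, NMDS property and optimality\<close>

lemma code_v_params: "linear_code_params (CARD('a) + 5) 3 (CARD('a) + 2) C"
proof -
  obtain c where "c \<in> C" "c $ 0 \<noteq> 0" using word_cover[of 0] by auto
  then have "\<exists>c\<in>C. c \<noteq> 0\<^sub>v (CARD('a) + 5)" by (intro bexI[of _ c]) auto
  then show ?thesis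
    by (simp add: linear_code_params_def linear_code_v code_dims min_weight_code_v)
qed

lemma code_v_NMDS: "NMDS (CARD('a) + 5) C"
  by (simp add: NMDS_def singleton_defect_def linear_code_v code_dims min_weight_code_v min_weight_dual)

text \<open>Here r = 2, k = 3 and d = q + 2 = n - k; dual words of weight at most 3 are the parity
  checks.\<close>

lemma code_v_optimal:
  "d_optimal_LRC (CARD('a) + 5) 3 2 C" "k_optimal_LRC (CARD('a) + 5) 3 2 C"
  using optimal_LRC_if_covered[OF linear_code_v, of 2] dual_word_cover
  by (simp_all add: code_dims min_weight_code_v)

text \<open>Here r = q + 1, k = q + 2 and d = 3 = n - k; codewords of weight at most q + 2 are the
  parity checks.\<close>

lemma dual_optimal:
  "d_optimal_LRC (CARD('a) + 5) (CARD('a) + 2) (CARD('a) + 1) C_dual"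
  "k_optimal_LRC (CARD('a) + 5) (CARD('a) + 2) (CARD('a) + 1) C_dual"
proof -
  have card2: "CARD('a) + 1 \<ge> 2" by (simp add: Suc_le_eq)
  have "\<exists>h\<in>dual_code (CARD('a) + 5) C_dual. h $ i \<noteq> 0 \<and> hamming_weight h \<le> CARD('a) + 1 + 1"
    if "i < CARD('a) + 5" for i
    using word_cover[OF that] subset_double_dual[OF code_v_subset] by fastforce
  from optimal_LRC_if_covered[OF linear_dual_code[OF code_v_subset] _ card2 _ _ this]
  show "d_optimal_LRC (CARD('a) + 5) (CARD('a) + 2) (CARD('a) + 1) C_dual"
    "k_optimal_LRC (CARD('a) + 5) (CARD('a) + 2) (CARD('a) + 1) C_dual"
    by (simp_all add: code_dims min_weight_dual)
qed

end

theorem theorem4p5: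
  fixes f :: "'a::{field,finite} poly" and v :: 'a and \<alpha> :: "nat \<Rightarrow> 'a" and m q :: nat
  assumes "m \<ge> 1" and "q = 2 ^ m" and "CARD('a) = q"
    and "o_polynomial f"
    and "v \<in> UNIV - {poly f x + x | x. x \<in> UNIV}"
    and "bij_betw \<alpha> {1..q} UNIV" and "\<alpha> q = 0"
  shows "linear_code_params (q + 5) 3 (q + 2) (code_v f \<alpha> v) \<and>
         NMDS (q + 5) (code_v f \<alpha> v) \<and>
         d_optimal_LRC (q + 5) 3 2 (code_v f \<alpha> v) \<and>
         k_optimal_LRC (q + 5) 3 2 (code_v f \<alpha> v) \<and>
         d_optimal_LRC (q + 5) (q + 2) (q + 1) (dual_code (q + 5) (code_v f \<alpha> v)) \<and>
         k_optimal_LRC (q + 5) (q + 2) (q + 1) (dual_code (q + 5) (code_v f \<alpha> v))"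
proof -
  interpret o_poly_points f v \<alpha>
    using assms char_two_if_card_power_two[where ?'a = 'a and m = m]
    by unfold_locales auto
  show ?thesis
    using code_v_params code_v_NMDS code_v_optimal dual_optimal
    unfolding assms(3) by blast
qed

end
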